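(* Let $n=p_{1}^{\alpha_{1}}p_{2}^{\alpha_{2}}\cdots p_{k}^{\alpha_{k}}$, where $p_1,\dots,p_k$ are distinct primes. The zero divisor graph $\Gamma[\mathbb{Z}_{n}]$ is not Eulerian for $\alpha_{i}\geq 2$, where $i=1,2,\dots,k$.
   Context: For a commutative ring $R$ with unity, let $Z[R]$ be the set of its zero divisors. The zero divisor graph $\Gamma[R]$ is the undirected graph with vertex set $Z^*[R]=Z[R]\setminus\{0\}$ (the non-zero zero divisors of $R$), in which two distinct vertices $v,w$ are adjacent if $vw=0$. $\mathbb{Z}_n$ denotes the ring of integers modulo $n$. An Euler tour of a graph $G$ is a tour (closed walk) that includes each edge of $G$ exactly once. A graph $G$ is called an Euler graph (or Eulerian) if it has an Euler tour. *)

theory Defs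
  imports "HOL-Number_Theory.Residues"
begin

definition zero_divisors :: "('a, 'b) ring_scheme \<Rightarrow> 'a set" where
  "zero_divisors R =
     {x \<in> carrier R. \<exists>y \<in> carrier R. y \<noteq> \<zero>\<^bsub>R\<^esub> \<and> x \<otimes>\<^bsub>R\<^esub> y = \<zero>\<^bsub>R\<^esub>}"

record 'a ugraph =
  verts :: "'a set"
  edges :: "'a set set"

definition zero_divisor_graph :: "('a, 'b) ring_scheme \<Rightarrow> 'a ugraph" where
  "zero_divisor_graph R =
     \<lparr>verts = zero_divisors R - {\<zero>\<^bsub>R\<^esub>},
      edges = {{v, w} | v w. v \<in> zero_divisors R - {\<zero>\<^bsub>R\<^esub>} \<and> w \<in> zero_divisors R - {\<zero>\<^bsub>R\<^esub>} \<and>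
                             v \<noteq> w \<and> v \<otimes>\<^bsub>R\<^esub> w = \<zero>\<^bsub>R\<^esub>}\<rparr>"

text \<open>In a simple graph a walk is determined by its sequence of vertices; a walk with
  vertices \<open>v\<^sub>0, \<dots>, v\<^sub>m\<close> has length \<open>m\<close>.\<close>

fun walk_edges :: "'a list \<Rightarrow> 'a set list" where
  "walk_edges [] = []"
| "walk_edges [v] = []"
| "walk_edges (v # w # vs) = {v, w} # walk_edges (w # vs)"

definition walk :: "'a ugraph \<Rightarrow> 'a list \<Rightarrow> bool" where
  "walk G vs \<longleftrightarrow> vs \<noteq> [] \<and> set vs \<subseteq> verts G \<and> set (walk_edges vs) \<subseteq> edges G"

text \<open>As in Bondy and Murty, a closed walk has positive length.  Hence a graph without
  edges, such as the one-vertex graph \<open>\<Gamma>[\<int>\<^sub>4]\<close>, has no Euler tour.\<close>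

definition closed_walk :: "'a ugraph \<Rightarrow> 'a list \<Rightarrow> bool" where
  "closed_walk G vs \<longleftrightarrow> walk G vs \<and> walk_edges vs \<noteq> [] \<and> hd vs = last vs"

definition euler_tour :: "'a ugraph \<Rightarrow> 'a list \<Rightarrow> bool" where
  "euler_tour G vs \<longleftrightarrow>
     closed_walk G vs \<and> (\<forall>e \<in> edges G. count_list (walk_edges vs) e = 1)"

definition eulerian :: "'a ugraph \<Rightarrow> bool" where
  "eulerian G \<longleftrightarrow> (\<exists>vs. euler_tour G vs)"

end

theory Submission
  imports Defs
begin

text \<open>The proof exhibits a vertex of odd degree. An Euler tour enters and leaves each vertex
  equally often and uses every edge once, so all degrees are even
  (\<open>eulerian_imp_even_degree\<close>). In \<open>\<Gamma>[\<int>\<^sub>n]\<close> a divisor \<open>d\<close> of \<open>n\<close> with \<open>1 < d < n\<close> is killed by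
  exactly the \<open>d\<close> multiples of \<open>n / d\<close>; discarding \<open>0\<close>, and \<open>d\<close> itself if \<open>d\<^sup>2 = 0\<close>, leaves its
  degree: \<open>d - 2\<close> if \<open>n\<close> divides \<open>d\<^sup>2\<close>, and \<open>d - 1\<close> otherwise (\<open>degree_of_divisor\<close>).

  If \<open>n\<close> is odd, take \<open>d = n / q\<close> for a prime \<open>q\<close> with \<open>q\<^sup>2\<close> dividing \<open>n\<close>: then \<open>d\<^sup>2 = 0\<close>, so the
  degree \<open>d - 2\<close> is odd. If \<open>n\<close> is even and \<open>n > 4\<close>, the vertex \<open>2\<close> is adjacent only to \<open>n / 2\<close>.
  Finally \<open>\<Gamma>[\<int>\<^sub>4]\<close> is a single vertex without edges, which carries no closed walk at all.\<close>

section \<open>Euler tours force even degrees\<close>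

text \<open>Every occurrence of \<open>v\<close> in a walk borders two steps, one on either side, except that the
  two ends of the walk each lack one. A loop at \<open>v\<close> would be one step bordered twice by \<open>v\<close>,
  which is why loops are excluded.\<close>

lemma steps_through_vertex:
  assumes "vs \<noteq> []" "{v} \<notin> set (walk_edges vs)"
  shows "length (filter (\<lambda>e. v \<in> e) (walk_edges vs))
           + of_bool (hd vs = v) + of_bool (last vs = v) = 2 * count_list vs v"
  using assms by (induction vs rule: walk_edges.induct) auto

lemma eulerian_imp_even_degree:
  assumes "eulerian G" and no_loop: "{v} \<notin> edges G"
  shows "even (card {e \<in> edges G. v \<in> e})"
proof -
  obtain vs where sub: "set (walk_edges vs) \<subseteq> edges G" and ne: "vs \<noteq> []"
    and closed: "hd vs = last vs" and once: "\<forall>e \<in> edges G. count_list (walk_edges vs) e = 1"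
    using assms by (auto simp: eulerian_def euler_tour_def closed_walk_def walk_def)
  have "edges G \<subseteq> set (walk_edges vs)"
    using once by (metis count_notin subsetI zero_neq_one)
  with sub have set_eq: "set (walk_edges vs) = edges G" by blast
  have "distinct (walk_edges vs)"
    using once sub by (auto simp: distinct_count_atmost_1 count_mset)
  then have "card {e \<in> edges G. v \<in> e} = length (filter (\<lambda>e. v \<in> e) (walk_edges vs))"
    by (metis distinct_card distinct_filter set_eq set_filter)
  moreover have "even (length (filter (\<lambda>e. v \<in> e) (walk_edges vs)))"
  proof -
    have "length (filter (\<lambda>e. v \<in> e) (walk_edges vs)) + 2 * of_bool (last vs = v)
            = 2 * count_list vs v"
      using steps_through_vertex[OF ne, of v] no_loop set_eq closed by simp
    then have "even (length (filter (\<lambda>e. v \<in> e) (walk_edges vs)) + 2 * of_bool (last vs = v))"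
      by simp
    then show ?thesis by simp
  qed
  ultimately show ?thesis by simp
qed

lemma eulerian_imp_edges_nonempty: "eulerian G \<Longrightarrow> edges G \<noteq> {}"
  by (auto simp: eulerian_def euler_tour_def closed_walk_def walk_def)

section \<open>Degrees of divisors in the zero divisor graph\<close>

lemma edges_zero_divisor_graph_residue_ring:
  assumes "n > 1"
  shows "edges (zero_divisor_graph (residue_ring n)) =
           {{v, w} | v w. v \<in> {0<..<n} \<and> w \<in> {0<..<n} \<and> v \<noteq> w \<and> n dvd v * w}"
proof -
  \<comment> \<open>Adjacent vertices witness each other's being zero divisors.\<close>
  have adj: "v \<in> zero_divisors (residue_ring n) - {0} \<and> w \<in> zero_divisors (residue_ring n) - {0} \<and>
              v \<noteq> w \<and> v * w mod n = 0
         \<longleftrightarrow> v \<in> {0<..<n} \<and> w \<in> {0<..<n} \<and> v \<noteq> w \<and> n dvd v * w" for v w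
    unfolding zero_divisors_def residue_ring_def
    by (auto simp: dvd_eq_mod_eq_0 mult.commute intro: bexI[of _ w] bexI[of _ v])
  show ?thesis
    using adj by (simp add: zero_divisor_graph_def residue_ring_def)
qed

lemma card_annihilator:
  assumes "d > 0" "d dvd n" "n > (0::int)"
  shows "card {x \<in> {0..<n}. n dvd d * x} = nat d"
proof -
  obtain m where n: "n = d * m" using assms by blast
  have m: "m > 0" using assms n by (simp add: zero_less_mult_iff)
  have "{x \<in> {0..<n}. n dvd d * x} = (*) m ` {0..<d}"
    using assms m unfolding n by (auto simp: zero_le_mult_iff mult.commute)
  moreover have "inj_on ((*) m) {0..<d}" using m by (auto intro: inj_onI)
  ultimately show ?thesis by (simp add: card_image)
qed

lemma degree_of_divisor:
  assumes "1 < d" "d < n" "d dvd n"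
  shows "card {e \<in> edges (zero_divisor_graph (residue_ring n)). d \<in> e} =
           (if n dvd d * d then nat d - 2 else nat d - 1)"
proof -
  define A where "A = {x \<in> {0..<n}. n dvd d * x}"
  have A: "finite A" "card A = nat d" "0 \<in> A" "d \<in> A \<longleftrightarrow> n dvd d * d"
  proof -
    have "A \<subseteq> {0..<n}" by (auto simp: A_def)
    then show "finite A" by (rule finite_subset) simp
    show "card A = nat d" using card_annihilator[of d n] assms by (simp add: A_def)
    show "0 \<in> A" "d \<in> A \<longleftrightarrow> n dvd d * d" using assms by (auto simp: A_def)
  qed
  have "{e \<in> edges (zero_divisor_graph (residue_ring n)). d \<in> e} = (\<lambda>w. {d, w}) ` (A - {0} - {d})"
  proof (intro equalityI subsetI)
    fix e assume "e \<in> {e \<in> edges (zero_divisor_graph (residue_ring n)). d \<in> e}"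
    then show "e \<in> (\<lambda>w. {d, w}) ` (A - {0} - {d})"
      using assms by (auto simp: edges_zero_divisor_graph_residue_ring A_def mult.commute insert_commute)
  next
    fix e assume "e \<in> (\<lambda>w. {d, w}) ` (A - {0} - {d})"
    then obtain w where "e = {d, w}" "w \<in> A - {0} - {d}" by blast
    then have "e = {d, w}" "w \<in> {0<..<n}" "d \<noteq> w" "n dvd d * w"
      by (auto simp: A_def)
    with assms show "e \<in> {e \<in> edges (zero_divisor_graph (residue_ring n)). d \<in> e}"
      by (simp add: edges_zero_divisor_graph_residue_ring)
        (metis less_trans zero_less_one)
  qed
  moreover have "inj_on (\<lambda>w. {d, w}) (A - {0} - {d})"
    by (auto intro!: inj_onI simp: doubleton_eq_iff)
  moreover have "card (A - {0} - {d}) = (if n dvd d * d then nat d - 2 else nat d - 1)"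
    using A assms by (auto simp: card_Diff_singleton_if)
  ultimately show ?thesis by (simp add: card_image)
qed

section \<open>A vertex of odd degree\<close>

lemma odd_degree_imp_not_eulerian:
  assumes "n > 1" "odd (card {e \<in> edges (zero_divisor_graph (residue_ring n)). v \<in> e})"
  shows "\<not> eulerian (zero_divisor_graph (residue_ring n))"
proof -
  have "{v} \<notin> edges (zero_divisor_graph (residue_ring n))"
    using assms(1) by (auto simp: edges_zero_divisor_graph_residue_ring)
  with eulerian_imp_even_degree assms(2) show ?thesis by metis
qed

text \<open>The parity of \<open>n\<close> decides the witness because \<open>n / q\<close> may have even degree when \<open>n\<close> is
  even: in \<open>\<Gamma>[\<int>\<^sub>8]\<close> the vertex \<open>4\<close> has the two neighbours \<open>2\<close> and \<open>6\<close>.\<close>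

lemma not_eulerian_if_prime_square_dvd:
  fixes n q :: int
  assumes "prime q" "q\<^sup>2 dvd n" "n > 0"
  shows "\<not> eulerian (zero_divisor_graph (residue_ring n))"
proof -
  have q: "q \<ge> 2" using assms(1) by (rule prime_ge_2_int)
  have "q\<^sup>2 \<ge> 2\<^sup>2" using q by (intro power_mono) auto
  moreover have "q\<^sup>2 \<le> n" using assms by (intro zdvd_imp_le)
  ultimately have n4: "n \<ge> 4" by simp
  consider "odd n" | "n = 4" | "even n" "n > 4" using n4 by linarith
  then show ?thesis
  proof cases
    case 1
    obtain m where m: "n = q\<^sup>2 * m" using assms by blast
    define d where "d = q * m"
    have n: "n = q * d" by (simp add: m d_def power2_eq_square)
    have "m > 0" using m assms q by (simp add: zero_less_mult_iff)
    then have "d \<ge> q * 1" unfolding d_def using q by (intro mult_left_mono) auto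
    with q have d: "d > 1" by simp
    have "d * 1 < d * q" using d q by (intro mult_strict_left_mono) auto
    then have "d < n" by (simp add: n mult.commute)
    moreover have "n dvd d * d" by (simp add: n d_def)
    moreover have "odd d" using 1 n by simp
    ultimately have "odd (card {e \<in> edges (zero_divisor_graph (residue_ring n)). d \<in> e})"
      using d n degree_of_divisor[of d n] by (simp add: even_nat_iff)
    then show ?thesis using n4 by (intro odd_degree_imp_not_eulerian) auto
  next
    case 2
    have "v = 2" if "v \<in> {0<..<4}" "w \<in> {0<..<4}" "v \<noteq> w" "4 dvd v * w" for v w :: int
    proof -
      have "v \<in> {1, 2, 3}" "w \<in> {1, 2, 3}" using that by auto
      with that show ?thesis by auto
    qed
    then have "edges (zero_divisor_graph (residue_ring n)) = {}"
      unfolding 2 by (auto simp: edges_zero_divisor_graph_residue_ring)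
         (metis greaterThanLessThan_iff mult.commute)
    then show ?thesis using eulerian_imp_edges_nonempty by blast
  next
    case 3
    then have "\<not> n dvd 2 * 2" by (auto dest: zdvd_imp_le)
    then have "card {e \<in> edges (zero_divisor_graph (residue_ring n)). 2 \<in> e} = 1"
      using 3 degree_of_divisor[of 2 n] by simp
    then show ?thesis using n4 by (intro odd_degree_imp_not_eulerian[of n 2]) auto
  qed
qed

theorem theorem4p3:
  fixes n k :: nat and p \<alpha> :: "nat \<Rightarrow> nat"
  assumes "k \<ge> 1"
    and "\<And>i. i \<in> {1..k} \<Longrightarrow> prime (p i)"
    and "inj_on p {1..k}"
    and "n = (\<Prod>i = 1..k. p i ^ \<alpha> i)"
    and "\<And>i. i \<in> {1..k} \<Longrightarrow> \<alpha> i \<ge> 2"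
  shows "\<not> eulerian (zero_divisor_graph (residue_ring (int n)))"
proof (rule not_eulerian_if_prime_square_dvd)
  have 1: "1 \<in> {1..k}" using assms(1) by simp
  show "prime (int (p 1))" using assms(2)[OF 1] by simp
  have "(p 1)\<^sup>2 dvd p 1 ^ \<alpha> 1" using assms(5)[OF 1] by (rule le_imp_power_dvd)
  also have "\<dots> dvd n" unfolding assms(4) using 1 by (intro dvd_prodI) auto
  finally show "(int (p 1))\<^sup>2 dvd int n" by (metis of_nat_dvd_iff of_nat_power)
  have "n > 0" unfolding assms(4) using assms(2) by (intro prod_pos) (auto dest: prime_gt_0_nat)
  then show "int n > 0" by simp
qed

end
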